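(* Let $q$ be a power of a prime $p$ and let $n,d\in\mathbb{Z}_{\geq 1}$. Then \[ \Delta_d(q^{n-1},q^n+1)=\mathrm{Int}\Bigl(\frac{2}{q}\Bigr)S_d(2,q^n+q^{n-1}-1)-\sum_{j=1}^{\frac{q^{n-1}-1}{q-1}}S_d\Bigl(3+(j-1)(q-1),\,q^n+q^{n-1}-2-(j-1)(q-1)\Bigr)+S_d(2q^{n-1}+1,\,q^n-q^{n-1}). \]
   Context: $\mathbb{F}_q$ is the finite field with $q$ elements, $A=\mathbb{F}_q[t]$, and $A_{d+}$ is the set of monic polynomials in $A$ of degree $d$. For $s\in\mathbb{Z}$ and $d\in\mathbb{Z}_{\geq0}$, $S_d(s)=\sum_{a\in A_{d+}}a^{-s}\in\mathbb{F}_q(t)$. For $s_1,s_2\in\mathbb{Z}_{>0}$ and $d\in\mathbb{Z}_{\geq 0}$, $S_d(s_1,s_2)=S_d(s_1)\sum_{d>d_2\geq 0}S_{d_2}(s_2)$. For $a,b\in\mathbb{Z}_{>0}$, $\Delta_d(a,b)=S_d(a)S_d(b)-S_d(a+b)$. $\mathrm{Int}(x)=1$ if $x$ is an integer and $0$ otherwise. An empty sum is $0$. *)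

theory Defs
  imports
    "HOL-Library.Cardinality"
    "HOL-Computational_Algebra.Computational_Algebra"
begin

text \<open>
  Throughout, the type variable \<open>'a\<close> stands for the finite field with \<open>q = CARD('a)\<close> elements,
  \<open>'a poly\<close> for its polynomial ring \<open>A\<close>, and \<open>'a poly fract\<close> for the field of rational functions.
\<close>

definition monic_polys :: "nat \<Rightarrow> 'a::{finite,field} poly set" where
  "monic_polys d = {a. lead_coeff a = 1 \<and> degree a = d}"

text \<open>\<open>sum\<close> is \<open>0\<close> on infinite sets, so the definition of \<open>Sd\<close> below depends on this fact.\<close>

lemma finite_monic_polys: "finite (monic_polys d :: 'a::{finite,field} poly set)"
proof (rule finite_subset)
  let ?L = "{xs :: 'a list. set xs \<subseteq> UNIV \<and> length xs \<le> Suc d}"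
  show "monic_polys d \<subseteq> Poly ` ?L"
  proof
    fix a :: "'a poly"
    assume "a \<in> monic_polys d"
    then have "degree a = d"
      by (simp add: monic_polys_def)
    then have "length (coeffs a) \<le> Suc d"
      by (simp add: coeffs_def)
    then have "Poly (coeffs a) \<in> Poly ` ?L"
      by (intro imageI) simp
    then show "a \<in> Poly ` ?L"
      by (simp only: Poly_coeffs)
  qed
  show "finite (Poly ` ?L)"
    by (rule finite_imageI, rule finite_lists_length_le, rule finite)
qed

definition Sd :: "nat \<Rightarrow> int \<Rightarrow> 'a::{finite,field} poly fract" where
  "Sd d s = (\<Sum>a\<in>monic_polys d. to_fract a powi (- s))"

text \<open>
  The next two functions are only meant for positive exponents; \<open>int\<close> is used so that differences
  of exponents are not truncated.
\<close>

definition Sd2 :: "nat \<Rightarrow> int \<Rightarrow> int \<Rightarrow> 'a::{finite,field} poly fract" where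
  "Sd2 d s1 s2 = Sd d s1 * (\<Sum>e<d. Sd e s2)"

definition Delta :: "nat \<Rightarrow> int \<Rightarrow> int \<Rightarrow> 'a::{finite,field} poly fract" where
  "Delta d a b = Sd d a * Sd d b - Sd d (a + b)"

definition Int_ind :: "rat \<Rightarrow> 'b::zero_neq_one" where
  "Int_ind x = (if x \<in> \<int> then 1 else 0)"

end

theory Submission
  imports Defs
begin

text \<open>
  Expand \<open>S\<^sub>d(a) S\<^sub>d(b)\<close> over pairs \<open>x \<noteq> y\<close> of monic polynomials and split each \<open>1 / (x\<^sup>a y\<^sup>b)\<close> into
  partial fractions whose poles are \<open>x - y\<close> together with \<open>x\<close> or \<open>y\<close>. For fixed \<open>x\<close> the difference
  \<open>x - y\<close> runs through all nonzero polynomials of degree below \<open>d\<close>, and summing over their leading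
  coefficients kills every power \<open>(x - y)\<^sup>-\<^sup>j\<close> with \<open>j\<close> not divisible by \<open>q - 1\<close>. This gives Chen's
  formula, expressing \<open>\<Delta>\<^sub>d(a, b)\<close> through the \<open>S\<^sub>d(a + b - j, j)\<close> with coefficients
  \<open>\<plusminus> (j - 1 choose a - 1) \<plusminus> (j - 1 choose b - 1)\<close>. For \<open>a = q\<^sup>n\<^sup>-\<^sup>1\<close> and \<open>b = q\<^sup>n + 1\<close> the two binomials
  are, modulo \<open>p\<close>, the indicators of \<open>q\<^sup>n\<^sup>-\<^sup>1 dvd j\<close> and of \<open>q\<^sup>n < j\<close>.
\<close>

section \<open>Binomial coefficients modulo a prime\<close>

text \<open>Absorption gives
  \<open>k * (p ^ N choose k) = p ^ N * (p ^ N - 1 choose (k - 1))\<close>. If \<open>p\<close> did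
  not divide the binomial, all of \<open>p ^ N\<close> would have to divide the smaller number
  \<open>k\<close>.\<close>

lemma prime_dvd_prime_power_choose:
  fixes p k N :: nat
  assumes "prime p" "0 < k" "k < p ^ N"
  shows "p dvd (p ^ N choose k)"
proof (rule ccontr)
  assume "\<not> p dvd (p ^ N choose k)"
  then have "coprime (p ^ N) (p ^ N choose k)"
    using assms(1) by (simp add: prime_imp_coprime)
  moreover have "p ^ N dvd k * (p ^ N choose k)"
    using assms(2) by (simp add: times_binomial_minus1_eq)
  ultimately have "p ^ N dvd k"
    by (simp add: coprime_dvd_mult_left_iff)
  with assms show False
    by (auto dest: dvd_imp_le)
qed

context
  fixes p Q N :: nat
  assumes p: "prime p" and p0: "of_nat p = (0 :: 'r::comm_semiring_1)" and Q: "Q = p ^ N"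
begin

lemma of_nat_choose_prime_power_eq_0:
  assumes "0 < k" "k < Q"
  shows "of_nat (Q choose k) = (0 :: 'r)"
proof -
  obtain c where "Q choose k = p * c"
    using prime_dvd_prime_power_choose[OF p] assms unfolding Q by blast
  then show ?thesis
    using p0 by simp
qed

text \<open>In Vandermonde's sum the coefficients \<open>Q choose k\<close> with
  \<open>0 < k < Q\<close> vanish. Only \<open>k = 0\<close> survives, and \<open>k = Q\<close> as
  well when the range \<open>k \<le> r\<close> reaches it.\<close>

lemma of_nat_choose_prime_power_add:
  assumes "r \<le> Q"
  shows "of_nat ((Q + m) choose r) = (of_nat (m choose r) + (if r = Q then 1 else 0) :: 'r)"
proof -
  have "0 < Q"
    unfolding Q using p by (simp add: prime_gt_0_nat)
  have "(of_nat ((Q + m) choose r) :: 'r) =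
      (\<Sum>k\<le>r. of_nat (Q choose k) * of_nat (m choose (r - k)))"
    by (simp flip: vandermonde)
  also have "\<dots> = (\<Sum>k\<in>(if r = Q then {0, Q} else {0}).
      of_nat (Q choose k) * of_nat (m choose (r - k)))"
    using assms by (intro sum.mono_neutral_right)
      (auto split: if_splits simp: of_nat_choose_prime_power_eq_0)
  also have "\<dots> = of_nat (m choose r) + (if r = Q then 1 else 0)"
    using \<open>0 < Q\<close> by simp
  finally show ?thesis .
qed

text \<open>The lower index \<open>Q - 1\<close> is below \<open>Q\<close>, so removing
  \<open>Q\<close> from \<open>m\<close> does not change the value. This reduces to
  \<open>m < Q\<close>, where only \<open>m = Q - 1\<close> gives a nonzero binomial.\<close>

lemma of_nat_choose_prime_power_minus_1:
  "of_nat (m choose (Q - 1)) = (if Q dvd Suc m then 1 else 0 :: 'r)"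
proof (induction m rule: less_induct)
  case (less m)
  have "0 < Q"
    unfolding Q using p by (simp add: prime_gt_0_nat)
  show ?case
  proof (cases "m < Q")
    case True
    then have "Q dvd Suc m \<longleftrightarrow> m = Q - 1"
      using \<open>0 < Q\<close> by (auto dest: dvd_imp_le)
    with True show ?thesis
      by (auto simp: binomial_eq_0)
  next
    case False
    have "Q dvd Suc m \<longleftrightarrow> Q dvd Suc (m - Q)"
      using False by (metis Suc_diff_le dvd_minus_self le_Suc_eq not_le)
    then show ?thesis
      using of_nat_choose_prime_power_add[of "Q - 1" "m - Q"] less.IH[of "m - Q"] False \<open>0 < Q\<close>
      by simp
  qed
qed

lemma of_nat_choose_prime_power:
  assumes "m < 2 * Q"
  shows "of_nat (m choose Q) = (if Q \<le> m then 1 else 0 :: 'r)"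
  using assms of_nat_choose_prime_power_add[of Q "m - Q"] by (auto simp: binomial_eq_0)

end

section \<open>Partial fractions\<close>

text \<open>\<open>P a b\<close> is the half of the partial fraction expansion whose second pole is
  \<open>v\<close>. The recursions say how it reacts to a factor \<open>w\<close>: the last is
  Pascal's rule, the first leaves over the term \<open>k = 0\<close>, and in the second only
  \<open>k = a\<close> contributes.\<close>

lemma sum_binomial_shift:
  fixes w v :: "'r::comm_ring_1"
  defines "P \<equiv> \<lambda>a b. \<Sum>k\<le>a+b. of_nat (k choose a) * w ^ Suc k * v ^ Suc (a + b - k)"
  shows "P 0 (Suc b) = w * v ^ Suc (Suc b) + w * P 0 b"
    and "P (Suc a) 0 = w * P a 0"
    and "P (Suc a) (Suc b) = w * (P a (Suc b) + P (Suc a) b)"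
proof -
  show "P 0 (Suc b) = w * v ^ Suc (Suc b) + w * P 0 b"
    unfolding P_def by (simp add: sum.atMost_Suc_shift sum_distrib_left mult_ac del: sum.atMost_Suc)
  show "P (Suc a) 0 = w * P a 0"
  proof -
    have "P a 0 = w ^ Suc a * v" for a
    proof -
      have "P a 0 = (\<Sum>k\<in>{a}. of_nat (k choose a) * w ^ Suc k * v ^ Suc (a - k))"
        unfolding P_def by (intro sum.mono_neutral_cong_right) (auto simp: binomial_eq_0)
      then show ?thesis
        by simp
    qed
    then show ?thesis
      by simp
  qed
  have "P (Suc a) (Suc b) = (\<Sum>k\<le>a + Suc b. of_nat (Suc k choose Suc a) * w ^ Suc (Suc k)
      * v ^ Suc (Suc a + Suc b - Suc k))"
    unfolding P_def by (simp add: sum.atMost_Suc_shift del: sum.atMost_Suc binomial_Suc_Suc)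
  also have "\<dots> = w * (P a (Suc b) + P (Suc a) b)"
    unfolding P_def
    by (simp add: sum_distrib_left sum.distrib algebra_simps del: sum.atMost_Suc)
  finally show "P (Suc a) (Suc b) = w * (P a (Suc b) + P (Suc a) b)" .
qed

text \<open>
  The partial fraction expansion of \<open>1 / (x\<^sup>a y\<^sup>b)\<close> in disguise: take \<open>u = 1 / x\<close>, \<open>v = 1 / y\<close> and
  \<open>w = 1 / (x + y)\<close>.
\<close>

lemma partial_fraction_power_Suc:
  fixes u v w :: "'r::comm_ring_1"
  assumes uv: "u * v = w * (u + v)"
  shows "u ^ Suc a * v ^ Suc b =
    (\<Sum>k\<le>a+b. of_nat (k choose a) * w ^ Suc k * v ^ Suc (a + b - k)) +
    (\<Sum>k\<le>b+a. of_nat (k choose b) * w ^ Suc k * u ^ Suc (b + a - k))"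
    (is "_ = ?P v a b + ?P u b a")
proof (induction "a + b" arbitrary: a b)
  case 0
  then show ?case
    using uv by (simp add: algebra_simps)
next
  case (Suc n)
  \<comment> \<open>One use of \<open>uv\<close> trades a factor \<open>u * v\<close> for
    \<open>w\<close> times a sum, which lowers the total exponent of \<open>u\<close> and
    \<open>v\<close> and drives the induction.\<close>
  have step: "u ^ Suc a * v ^ Suc b = w * (u * (u ^ a * v ^ b)) + w * (v * (u ^ a * v ^ b))" for a b
  proof -
    have "u ^ Suc a * v ^ Suc b = (u * v) * (u ^ a * v ^ b)"
      by (simp add: mult_ac)
    then show ?thesis
      unfolding uv by (simp add: algebra_simps)
  qed
  consider b' where "a = 0" "b = Suc b'" | a' where "a = Suc a'" "b = 0"
    | a' b' where "a = Suc a'" "b = Suc b'"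
    using Suc.hyps(2) by (cases a; cases b) auto
  then show ?case
  proof cases
    \<comment> \<open>One of the two products no longer contains \<open>u\<close>, so no induction
      hypothesis covers it. This pure power is exactly the leftover term in the first recursion for
      \<open>P\<close>. Case 2 is the mirror image.\<close>
    case 1
    have "u ^ Suc 0 * v ^ Suc b' = ?P v 0 b' + ?P u b' 0"
      by (rule Suc.hyps) (use Suc.hyps 1 in simp)
    moreover have "u ^ Suc 0 * v ^ Suc (Suc b') = w * v ^ Suc (Suc b') + w * (u ^ Suc 0 * v ^ Suc b')"
      using step[of 0 "Suc b'"] by (simp add: algebra_simps)
    ultimately show ?thesis
      unfolding 1 sum_binomial_shift by (simp only: distrib_left add_ac)
  next
    case 2
    have "u ^ Suc a' * v ^ Suc 0 = ?P v a' 0 + ?P u 0 a'"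
      by (rule Suc.hyps) (use Suc.hyps 2 in simp)
    moreover have "u ^ Suc (Suc a') * v ^ Suc 0 = w * u ^ Suc (Suc a') + w * (u ^ Suc a' * v ^ Suc 0)"
      using step[of "Suc a'" 0] by (simp add: algebra_simps)
    ultimately show ?thesis
      unfolding 2 sum_binomial_shift by (simp only: distrib_left add_ac)
  next
    case 3
    have "u ^ Suc (Suc a') * v ^ Suc b' = ?P v (Suc a') b' + ?P u b' (Suc a')"
      by (rule Suc.hyps) (use Suc.hyps 3 in simp)
    moreover have "u ^ Suc a' * v ^ Suc (Suc b') = ?P v a' (Suc b') + ?P u (Suc b') a'"
      by (rule Suc.hyps) (use Suc.hyps 3 in simp)
    moreover have "u ^ Suc (Suc a') * v ^ Suc (Suc b') =
        w * (u ^ Suc (Suc a') * v ^ Suc b') + w * (u ^ Suc a' * v ^ Suc (Suc b'))"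
      using step[of "Suc a'" "Suc b'"] by (simp add: algebra_simps)
    ultimately show ?thesis
      unfolding 3 sum_binomial_shift by (simp only: distrib_left add_ac)
  qed
qed

text \<open>The shift \<open>j = k + 1\<close> makes \<open>j\<close> the exponent of
  \<open>w\<close>, so that both halves merge into one sum over \<open>j\<close>.\<close>

lemma partial_fraction_power:
  fixes u v w :: "'r::comm_ring_1"
  assumes "u * v = w * (u + v)" "0 < a" "0 < b"
  shows "u ^ a * v ^ b = (\<Sum>j\<in>{1..<a+b}. w ^ j *
    (of_nat ((j - 1) choose (a - 1)) * v ^ (a + b - j) +
     of_nat ((j - 1) choose (b - 1)) * u ^ (a + b - j)))"
proof -
  obtain a' b' where [simp]: "a = Suc a'" "b = Suc b'"
    using assms(2,3) by (auto simp: gr0_conv_Suc)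
  have "(\<Sum>j\<in>{1..<a+b}. w ^ j *
      (of_nat ((j - 1) choose (a - 1)) * v ^ (a + b - j) +
       of_nat ((j - 1) choose (b - 1)) * u ^ (a + b - j))) =
     (\<Sum>k\<le>a'+b'. w ^ Suc k *
      (of_nat (k choose a') * v ^ Suc (a' + b' - k) +
       of_nat (k choose b') * u ^ Suc (a' + b' - k)))"
    by (rule sum.reindex_bij_witness[of _ Suc "\<lambda>j. j - 1"]) (auto simp: Suc_diff_le)
  then show ?thesis
    using partial_fraction_power_Suc[OF assms(1), of a' b']
    by (simp add: sum.distrib algebra_simps del: sum.atMost_Suc power_Suc)
qed

section \<open>Power sums over the nonzero elements of a finite field\<close>

text \<open>Multiplication by \<open>x\<close> permutes the nonzero elements, hence preserves their
  product, which can be cancelled.\<close>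

lemma power_CARD_minus_1_eq_1:
  fixes x :: "'a::{finite,field}"
  assumes "x \<noteq> 0"
  shows "x ^ (CARD('a) - 1) = 1"
proof -
  have "(\<Prod>y\<in>UNIV-{0}. y) = (\<Prod>y\<in>UNIV-{0}. x * y)"
    by (rule prod.reindex_bij_witness[of _ "\<lambda>y. x * y" "\<lambda>y. y / x"]) (use assms in auto)
  also have "\<dots> = x ^ (CARD('a) - 1) * (\<Prod>y\<in>UNIV-{0}. y)"
    by (simp add: prod.distrib)
  finally show ?thesis
    by simp
qed

lemma power_eq_1_if_CARD_minus_1_dvd:
  fixes x :: "'a::{finite,field}"
  assumes "x \<noteq> 0" "(CARD('a) - 1) dvd k"
  shows "x ^ k = 1"
  using assms(2) by (elim dvdE) (simp only: power_mult power_CARD_minus_1_eq_1[OF assms(1)] power_one)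

text \<open>Translation by \<open>1\<close> permutes the field, so it does not change the sum of all
  elements.\<close>

lemma of_nat_CARD_eq_0: "of_nat CARD('a) = (0 :: 'a::{finite,field})"
proof -
  have "(\<Sum>x\<in>UNIV. x) = (\<Sum>x\<in>UNIV. x + 1 :: 'a)"
    by (rule sum.reindex_bij_witness[of _ "\<lambda>y. y + 1" "\<lambda>y. y - 1"]) auto
  then show ?thesis
    by (simp add: sum.distrib)
qed

text \<open>If every summand is \<open>1\<close>, the sum is \<open>q - 1 = -1\<close> in the field.
  Otherwise scaling by some \<open>g\<close> with \<open>g ^ k \<noteq> 1\<close> permutes the
  summands and multiplies the sum by \<open>g ^ k\<close>, so the sum is \<open>0\<close>.\<close>

lemma sum_power_nonzero_finite_field:
  "(\<Sum>x\<in>UNIV-{0}. x ^ k) = (if (CARD('a) - 1) dvd k then -1 else 0 :: 'a::{finite,field})"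
proof (cases "(CARD('a) - 1) dvd k")
  case True
  have "(\<Sum>x\<in>UNIV-{0}. x ^ k) = (\<Sum>x\<in>UNIV-{0::'a}. 1 :: 'a)"
  proof (rule sum.cong)
    fix x :: 'a
    assume "x \<in> UNIV - {0}"
    with True show "x ^ k = 1"
      by (simp add: power_eq_1_if_CARD_minus_1_dvd)
  qed simp
  also have "\<dots> = -1"
    using of_nat_CARD_eq_0[where 'a = 'a] finite_UNIV_card_ge_0[where 'a = 'a]
    by (simp add: of_nat_diff)
  finally show ?thesis
    using True by simp
next
  case False
  define r where "r = k mod (CARD('a) - 1)"
  have two: "2 \<le> CARD('a)"
    using card_mono[of UNIV "{0, 1 :: 'a}"] by simp
  then have r: "0 < r" "r < CARD('a) - 1"
    using False by (auto simp: r_def dvd_eq_mod_eq_0)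
  have pow: "x ^ k = x ^ r" if "x \<noteq> 0" for x :: 'a
  proof -
    have "x ^ k = x ^ ((CARD('a) - 1) * (k div (CARD('a) - 1)) + r)"
      by (simp add: r_def)
    then show ?thesis
      by (simp only: power_add power_mult power_CARD_minus_1_eq_1[OF that] power_one mult_1)
  qed
  \<comment> \<open>Without such a \<open>g\<close>, the nonzero polynomial \<open>P\<close> of
    degree at most \<open>r < q - 1\<close> would have \<open>q - 1\<close> roots.\<close>
  have "\<exists>g::'a. g \<noteq> 0 \<and> g ^ k \<noteq> 1"
  proof (rule ccontr)
    assume "\<nexists>g::'a. g \<noteq> 0 \<and> g ^ k \<noteq> 1"
    then have *: "x ^ r = 1" if "x \<noteq> 0" for x :: 'a
      using that pow[OF that] by metis
    define P :: "'a poly" where "P = monom 1 r - 1"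
    have "coeff P r = 1"
      using r by (simp add: P_def)
    then have "P \<noteq> 0"
      by auto
    have "degree P \<le> r"
      by (auto simp: P_def intro!: degree_diff_le degree_monom_le)
    moreover have "card (UNIV - {0 :: 'a}) \<le> card {x. poly P x = 0}"
      by (intro card_mono) (auto simp: P_def poly_monom *)
    ultimately show False
      using card_poly_roots_bound[OF \<open>P \<noteq> 0\<close>] r by simp
  qed
  then obtain g :: 'a where g: "g \<noteq> 0" "g ^ k \<noteq> 1"
    by blast
  have "(\<Sum>x\<in>UNIV-{0}. x ^ k) = (\<Sum>x\<in>UNIV-{0}. (g * x) ^ k)"
    by (rule sum.reindex_bij_witness[of _ "\<lambda>x. g * x" "\<lambda>x. x / g"]) (use g in auto)
  also have "\<dots> = g ^ k * (\<Sum>x\<in>UNIV-{0}. x ^ k)"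
    by (simp add: power_mult_distrib sum_distrib_left)
  finally have "(g ^ k - 1) * (\<Sum>x\<in>UNIV-{0}. x ^ k) = 0"
    by (simp add: algebra_simps)
  with g False show ?thesis
    by simp
qed

lemma sum_inverse_power_nonzero_finite_field:
  "(\<Sum>x\<in>UNIV-{0}. inverse x ^ k) = (if (CARD('a) - 1) dvd k then -1 else 0 :: 'a::{finite,field})"
proof -
  have "(\<Sum>x\<in>UNIV-{0}. inverse x ^ k) = (\<Sum>x\<in>UNIV-{0::'a}. x ^ k)"
    by (rule sum.reindex_bij_witness[of _ inverse inverse]) auto
  then show ?thesis
    by (simp add: sum_power_nonzero_finite_field)
qed

section \<open>Power sums over polynomials of bounded degree\<close>

lemma Sd_int: "Sd d (int s) = (\<Sum>a\<in>monic_polys d. inverse (to_fract a) ^ s)"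
  by (simp add: Sd_def power_int_minus power_inverse)

lemma to_fract_power: "to_fract (x ^ n) = to_fract x ^ n"
  by (induction n) auto

lemma to_fract_of_nat: "to_fract (of_nat n) = of_nat n"
  by (induction n) auto

lemma sum_const_poly: "(\<Sum>x\<in>A. [:f x:]) = [:\<Sum>x\<in>A. f x:]"
  by (induction A rule: infinite_finite_induct) auto

lemma const_poly_minus_1: "[:-1:] = (-1 :: 'a::comm_ring_1 poly)"
  by (simp add: one_pCons)

lemma smult_monic_decomposition:
  "bij_betw (\<lambda>(c, e, m). smult c m) ((UNIV - {0}) \<times> (SIGMA e:{..<d}. monic_polys e))
    ({z. z \<noteq> 0 \<and> degree z < d} :: 'a::{finite,field} poly set)"
  by (rule bij_betwI[where g = "\<lambda>z. (lead_coeff z, degree z, smult (inverse (lead_coeff z)) z)"])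
    (auto simp: monic_polys_def)

text \<open>Writing \<open>z\<close> as leading coefficient times monic polynomial factors the sum.
  The factor over the coefficients is \<open>-1\<close> or \<open>0\<close>; the factor over the
  monic polynomials is the inner sum of \<open>Sd2\<close>.\<close>

lemma sum_inverse_power_degree_less:
  "(\<Sum>z\<in>{z :: 'a::{finite,field} poly. z \<noteq> 0 \<and> degree z < d}. inverse (to_fract z) ^ j) =
    (if (CARD('a) - 1) dvd j then - (\<Sum>e<d. Sd e (int j)) else 0)"
proof -
  have const: "inverse (to_fract [:c:]) = to_fract [:inverse c:]" if "c \<noteq> 0" for c :: 'a
    using that by (intro inverse_unique) (simp flip: to_fract_mult one_pCons)
  have "(\<Sum>z\<in>{z :: 'a poly. z \<noteq> 0 \<and> degree z < d}. inverse (to_fract z) ^ j) =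
      (\<Sum>(c, e, m)\<in>(UNIV - {0}) \<times> (SIGMA e:{..<d}. monic_polys e).
        inverse (to_fract (smult c m)) ^ j)"
    by (subst sum.reindex_bij_betw[OF smult_monic_decomposition, symmetric])
      (simp add: case_prod_unfold)
  also have "\<dots> = (\<Sum>(c, e, m)\<in>(UNIV - {0}) \<times> (SIGMA e:{..<d}. monic_polys e).
        to_fract [:inverse c ^ j:] * inverse (to_fract m) ^ j)"
  proof (rule sum.cong, goal_cases)
    case (2 x)
    obtain c e m where x: "x = (c, e, m)"
      by (cases x) auto
    have "smult c m = [:c:] * m" "[:inverse c ^ j:] = [:inverse c:] ^ j"
      by (simp_all add: poly_const_pow)
    moreover have "inverse (to_fract [:c:]) = to_fract [:inverse c:]"
      using 2 x by (intro const) simp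
    ultimately show ?case
      by (simp only: x prod.case to_fract_mult inverse_mult_distrib power_mult_distrib to_fract_power)
  qed simp
  also have "\<dots> = (\<Sum>c\<in>UNIV-{0 :: 'a}. to_fract [:inverse c ^ j:]) *
      (\<Sum>e<d. \<Sum>m\<in>monic_polys e. inverse (to_fract m) ^ j)"
    by (simp add: sum.cartesian_product sum_product sum.Sigma finite_monic_polys case_prod_unfold
        flip: sum.cartesian_product)
  also have "(\<Sum>c\<in>UNIV-{0 :: 'a}. to_fract [:inverse c ^ j:]) =
      to_fract [:\<Sum>c\<in>UNIV-{0}. inverse c ^ j:]"
    by (simp flip: to_fract_sum add: sum_const_poly)
  finally show ?thesis
    by (simp add: sum_inverse_power_nonzero_finite_field Sd_int const_poly_minus_1)
qed

text \<open>The leading terms cancel in \<open>x - y\<close>, and the map is its own inverse. For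
  \<open>d = 0\<close> both sets are empty.\<close>

lemma monic_polys_diff:
  assumes "x \<in> monic_polys d"
  shows "bij_betw (\<lambda>y. x - y) (monic_polys d - {x})
    ({z. z \<noteq> 0 \<and> degree z < d} :: 'a::{finite,field} poly set)"
    (is "bij_betw _ _ ?Z")
proof (rule bij_betwI[where g = "\<lambda>z. x - z"])
  show "(\<lambda>y. x - y) \<in> monic_polys d - {x} \<rightarrow> ?Z"
  proof
    fix y
    assume y: "y \<in> monic_polys d - {x}"
    then have "coeff (x - y) d = 0" "degree (x - y) \<le> d" "x - y \<noteq> 0"
      using assms by (auto simp: monic_polys_def intro: degree_diff_le)
    then show "x - y \<in> ?Z"
      by (metis (mono_tags) leading_coeff_0_iff le_neq_implies_less mem_Collect_eq)
  qed
  show "(\<lambda>z. x - z) \<in> ?Z \<rightarrow> monic_polys d - {x}"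
  proof
    fix z
    assume z: "z \<in> ?Z"
    have "degree (x - z) = d"
      using degree_add_eq_left[of "- z" x] z assms by (auto simp: monic_polys_def)
    with z assms show "x - z \<in> monic_polys d - {x}"
      by (auto simp: monic_polys_def coeff_eq_0)
  qed
qed auto

text \<open>The identity holds in the finite field because \<open>-1\<close> is nonzero there, and
  constants carry it to rational functions. This avoids a case split on the parity of
  \<open>q\<close>.\<close>

lemma minus_one_power_CARD_minus_1_dvd:
  assumes "(CARD('a::{finite,field}) - 1) dvd j"
  shows "(-1) ^ j = (1 :: 'a poly fract)"
proof -
  have "(-1) ^ j = (1 :: 'a)"
    using assms by (simp add: power_eq_1_if_CARD_minus_1_dvd)
  then have "[:(-1) ^ j:] = (1 :: 'a poly)"
    by (simp flip: one_pCons)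
  moreover have "[:(-1) ^ j:] = ((-1) ^ j :: 'a poly)"
    by (simp flip: poly_const_pow add: const_poly_minus_1)
  ultimately have "to_fract ((-1) ^ j :: 'a poly) = 1"
    by simp
  then show ?thesis
    by (simp only: to_fract_power to_fract_uminus to_fract_1)
qed

section \<open>Chen's formula\<close>

text \<open>The signs have exponents \<open>Suc a\<close> and \<open>Suc b\<close> rather than
  \<open>a\<close> and \<open>b\<close> because the sum over leading coefficients contributes a
  further \<open>-1\<close>.\<close>

lemma Delta_eq_sum_Sd2:
  fixes d a b :: nat
  assumes "0 < a" "0 < b"
  shows "(Delta d (int a) (int b) :: 'a::{finite,field} poly fract) =
    (\<Sum>j\<in>{j\<in>{1..<a+b}. (CARD('a) - 1) dvd j}.
      ((-1) ^ Suc a * of_nat ((j - 1) choose (a - 1)) +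
       (-1) ^ Suc b * of_nat ((j - 1) choose (b - 1))) * Sd2 d (int (a + b - j)) (int j))"
proof -
  define M where "M = (monic_polys d :: 'a poly set)"
  define h where "h x = inverse (to_fract x)" for x :: "'a poly"
  define Z where "Z j = (\<Sum>z\<in>{z :: 'a poly. z \<noteq> 0 \<and> degree z < d}. h z ^ j)" for j
  have fin: "finite M"
    by (simp add: M_def finite_monic_polys)
  have Sd: "Sd d (int s) = (\<Sum>x\<in>M. h x ^ s)" for s
    by (simp add: Sd_int M_def h_def)
  have inner: "(\<Sum>y\<in>M-{x}. h (x - y) ^ j) = Z j" if "x \<in> M" for x j
    unfolding Z_def M_def by (rule sum.reindex_bij_betw[OF monic_polys_diff]) (use that M_def in auto)
  have inner': "(\<Sum>x\<in>M-{y}. h (x - y) ^ j) = (-1) ^ j * Z j" if "y \<in> M" for y j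
  proof -
    have "h (x - y) ^ j = (-1) ^ j * h (y - x) ^ j" for x
    proof -
      have "h (x - y) = (-1) * h (y - x)"
        by (simp add: h_def flip: inverse_minus_eq)
      then show ?thesis
        by (simp only: power_mult_distrib)
    qed
    then show ?thesis
      using inner[OF that] by (simp flip: sum_distrib_left)
  qed
  have swap: "(\<Sum>x\<in>M. \<Sum>y\<in>M-{x}. f x y) = (\<Sum>y\<in>M. \<Sum>x\<in>M-{y}. f x y)" for f :: "_ \<Rightarrow> _ \<Rightarrow> 'a poly fract"
  proof -
    have "(\<Sum>x\<in>M. \<Sum>y\<in>{y\<in>M. x \<noteq> y}. f x y) = (\<Sum>y\<in>M. \<Sum>x\<in>{x\<in>M. x \<noteq> y}. f x y)"
      using fin by (rule sum.swap_restrict) (rule fin)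
    moreover have "{y\<in>M. x \<noteq> y} = M - {x}" "{y\<in>M. y \<noteq> x} = M - {x}" for x
      by auto
    ultimately show ?thesis
      by simp
  qed
  have reorder: "(\<Sum>x\<in>M. \<Sum>y\<in>M-{x}. \<Sum>j\<in>J. f x y j) = (\<Sum>j\<in>J. \<Sum>x\<in>M. \<Sum>y\<in>M-{x}. f x y j)"
    for J :: "nat set" and f :: "_ \<Rightarrow> _ \<Rightarrow> _ \<Rightarrow> 'a poly fract"
  proof -
    have "(\<Sum>x\<in>M. \<Sum>y\<in>M-{x}. \<Sum>j\<in>J. f x y j) = (\<Sum>x\<in>M. \<Sum>j\<in>J. \<Sum>y\<in>M-{x}. f x y j)"
      by (intro sum.cong refl sum.swap)
    also have "\<dots> = (\<Sum>j\<in>J. \<Sum>x\<in>M. \<Sum>y\<in>M-{x}. f x y j)"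
      by (rule sum.swap)
    finally show ?thesis .
  qed
  have sq: "(-1) ^ b * ((-1) ^ b * z) = z" for z :: "'a poly fract"
    by (simp flip: mult.assoc power_mult_distrib)
  have pm: "(- h x) ^ i = (-1) ^ i * h x ^ i" for x i
    by (rule power_minus)
  \<comment> \<open>Partial fractions with \<open>u = h x\<close>, \<open>v = - h y\<close> and
    \<open>w = h (x - y)\<close>; the factor \<open>(-1) ^ b\<close> undoes the sign put into
    \<open>v\<close>.\<close>
  have pf: "h x ^ a * h y ^ b = (-1) ^ b * (\<Sum>j\<in>{1..<a+b}. h (x - y) ^ j *
      (of_nat ((j - 1) choose (a - 1)) * (- h y) ^ (a + b - j) +
       of_nat ((j - 1) choose (b - 1)) * h x ^ (a + b - j)))"
    if "x \<in> M" "y \<in> M - {x}" for x y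
  proof -
    have "to_fract x \<noteq> 0" "to_fract y \<noteq> 0" "to_fract x - to_fract y \<noteq> 0"
      using that by (auto simp: M_def monic_polys_def)
    then have "h x * (- h y) = h (x - y) * (h x + - h y)"
      by (simp add: h_def field_simps)
    from partial_fraction_power[OF this assms]
    have "h x ^ a * (- h y) ^ b = (\<Sum>j\<in>{1..<a+b}. h (x - y) ^ j *
      (of_nat ((j - 1) choose (a - 1)) * (- h y) ^ (a + b - j) +
       of_nat ((j - 1) choose (b - 1)) * h x ^ (a + b - j)))" .
    moreover have "h x ^ a * h y ^ b = (-1) ^ b * (h x ^ a * (- h y) ^ b)"
      by (simp only: pm sq mult.left_commute[of "h x ^ a"])
    ultimately show ?thesis
      by simp
  qed
  have "Delta d (int a) (int b) =
      (\<Sum>x\<in>M. \<Sum>y\<in>M. h x ^ a * h y ^ b) - (\<Sum>x\<in>M. h x ^ a * h x ^ b)"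
    by (simp add: Delta_def Sd sum_product power_add flip: of_nat_add)
  \<comment> \<open>The term \<open>Sd d (a + b)\<close> removes exactly the diagonal
    \<open>x = y\<close>.\<close>
  also have "\<dots> = (\<Sum>x\<in>M. \<Sum>y\<in>M-{x}. h x ^ a * h y ^ b)"
    unfolding sum_subtractf[symmetric] by (rule sum.cong) (simp_all add: sum_diff1 fin)
  also have "\<dots> = (\<Sum>x\<in>M. \<Sum>y\<in>M-{x}. (-1) ^ b * (\<Sum>j\<in>{1..<a+b}. h (x - y) ^ j *
      (of_nat ((j - 1) choose (a - 1)) * (- h y) ^ (a + b - j) +
       of_nat ((j - 1) choose (b - 1)) * h x ^ (a + b - j))))"
    by (intro sum.cong refl pf)
  also have "\<dots> = (-1) ^ b * (\<Sum>j\<in>{1..<a+b}. \<Sum>x\<in>M. \<Sum>y\<in>M-{x}. h (x - y) ^ j *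
      (of_nat ((j - 1) choose (a - 1)) * (- h y) ^ (a + b - j) +
       of_nat ((j - 1) choose (b - 1)) * h x ^ (a + b - j)))"
    unfolding reorder[symmetric] by (simp only: sum_distrib_left)
  also have "\<dots> = (-1) ^ b * (\<Sum>j\<in>{1..<a+b}.
      of_nat ((j - 1) choose (a - 1)) * (-1) ^ (a + b) * Sd d (int (a + b - j)) * Z j +
      of_nat ((j - 1) choose (b - 1)) * Sd d (int (a + b - j)) * Z j)"
  proof (intro arg_cong2[where f = "(*)"] sum.cong refl)
    fix j
    assume j: "j \<in> {1..<a+b}"
    \<comment> \<open>One sign comes from the power of \<open>- h y\<close>, the other from
      reversing \<open>x - y\<close> in \<open>inner'\<close>; their product does not depend on
      \<open>j\<close>.\<close>
    have sgn: "(-1) ^ (a + b) = (-1) ^ (a + b - j) * (-1 :: 'a poly fract) ^ j"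
      using j by (simp flip: power_add)
    have "(\<Sum>x\<in>M. \<Sum>y\<in>M-{x}. h (x - y) ^ j *
        (of_nat ((j - 1) choose (a - 1)) * (- h y) ^ (a + b - j) +
         of_nat ((j - 1) choose (b - 1)) * h x ^ (a + b - j))) =
      (\<Sum>x\<in>M. \<Sum>y\<in>M-{x}. h (x - y) ^ j * (of_nat ((j - 1) choose (a - 1)) * (- h y) ^ (a + b - j))) +
      (\<Sum>x\<in>M. \<Sum>y\<in>M-{x}. h (x - y) ^ j * (of_nat ((j - 1) choose (b - 1)) * h x ^ (a + b - j)))"
      by (simp add: distrib_left sum.distrib)
    also have "(\<Sum>x\<in>M. \<Sum>y\<in>M-{x}. h (x - y) ^ j * (of_nat ((j - 1) choose (b - 1)) * h x ^ (a + b - j))) =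
        (\<Sum>x\<in>M. Z j * (of_nat ((j - 1) choose (b - 1)) * h x ^ (a + b - j)))"
      by (simp add: inner flip: sum_distrib_right)
    also have "\<dots> = of_nat ((j - 1) choose (b - 1)) * Sd d (int (a + b - j)) * Z j"
      unfolding Sd by (simp add: sum_distrib_left sum_distrib_right mult_ac)
    also have "(\<Sum>x\<in>M. \<Sum>y\<in>M-{x}. h (x - y) ^ j * (of_nat ((j - 1) choose (a - 1)) * (- h y) ^ (a + b - j))) =
        (\<Sum>y\<in>M. (-1) ^ j * Z j * (of_nat ((j - 1) choose (a - 1)) * (- h y) ^ (a + b - j)))"
      by (subst swap) (simp add: inner' flip: sum_distrib_right)
    also have "\<dots> = (\<Sum>y\<in>M. of_nat ((j - 1) choose (a - 1)) * (-1) ^ (a + b) * Z j * h y ^ (a + b - j))"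
      unfolding sgn by (intro sum.cong refl) (simp only: pm mult_ac)
    also have "\<dots> = of_nat ((j - 1) choose (a - 1)) * (-1) ^ (a + b) * Sd d (int (a + b - j)) * Z j"
      unfolding Sd by (simp add: sum_distrib_left sum_distrib_right mult_ac)
    finally show "(\<Sum>x\<in>M. \<Sum>y\<in>M-{x}. h (x - y) ^ j *
        (of_nat ((j - 1) choose (a - 1)) * (- h y) ^ (a + b - j) +
         of_nat ((j - 1) choose (b - 1)) * h x ^ (a + b - j))) =
      of_nat ((j - 1) choose (a - 1)) * (-1) ^ (a + b) * Sd d (int (a + b - j)) * Z j +
      of_nat ((j - 1) choose (b - 1)) * Sd d (int (a + b - j)) * Z j" .
  qed
  \<comment> \<open>The minus sign is pulled out in advance: \<open>Z j\<close> is either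
    \<open>0\<close> or minus the inner sum of \<open>Sd2\<close>.\<close>
  also have "\<dots> = (\<Sum>j\<in>{1..<a+b}. - ((-1) ^ Suc a * of_nat ((j - 1) choose (a - 1)) +
       (-1) ^ Suc b * of_nat ((j - 1) choose (b - 1))) * (Sd d (int (a + b - j)) * Z j))"
    unfolding sum_distrib_left
    by (intro sum.cong refl) (simp add: power_add algebra_simps sq)
  also have "\<dots> = (\<Sum>j\<in>{j\<in>{1..<a+b}. (CARD('a) - 1) dvd j}.
      ((-1) ^ Suc a * of_nat ((j - 1) choose (a - 1)) +
       (-1) ^ Suc b * of_nat ((j - 1) choose (b - 1))) * Sd2 d (int (a + b - j)) (int j))"
    by (rule sum.mono_neutral_cong_right)
      (auto simp: Z_def h_def sum_inverse_power_degree_less Sd2_def algebra_simps)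
  finally show ?thesis .
qed

section \<open>Selecting the surviving indices\<close>

text \<open>Since \<open>Q\<close> is \<open>1\<close> modulo \<open>q - 1\<close>, few multiples of
  \<open>Q\<close> in the range are also multiples of \<open>q - 1\<close>. For \<open>q > 2\<close>
  the index \<open>q * Q + Q - 1\<close> is not a multiple of \<open>q - 1\<close>; for
  \<open>q = 2\<close> every index is allowed, which produces the extra term.\<close>

lemma sum_weighted_multiples:
  fixes q Q :: nat and G :: "nat \<Rightarrow> 'r::comm_ring_1"
  assumes q: "2 \<le> q" and Q: "0 < Q" "(q - 1) dvd (Q - 1)" and char2: "q = 2 \<Longrightarrow> (2 :: 'r) = 0"
  shows "(\<Sum>j\<in>{j\<in>{1..<Q+(q*Q+1)}. (q - 1) dvd j}.
      ((if Q dvd j then 1 else 0) - (if q * Q < j then 1 else 0)) * G j) =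
    (if q = 2 then G (q * Q + Q - 1) else 0) -
    (\<Sum>i<(Q - 1) div (q - 1). G (q * Q + Q - 2 - i * (q - 1))) + G (q * Q - Q)"
    (is "sum ?f ?J = _")
proof -
  define r where "r = q - 1"
  define t where "t = (Q - 1) div r"
  have r: "q = Suc r" "1 \<le> r"
    using q by (auto simp: r_def)
  have Qt: "Q = Suc (r * t)"
    using Q by (simp add: t_def r_def)
  have fin: "finite ?J"
    by simp
  have J: "?J = {j. 1 \<le> j \<and> j \<le> q * Q + Q \<and> r dvd j}"
    by (auto simp: r_def)
  have main: "q * Q - Q = r * Q" "r * Q \<in> ?J"
    using r Q by (auto simp: J)
  show ?thesis
  proof (cases "q = 2")
    case True
    then have "r = 1"
      using r by simp
    have neg: "- x = x" for x :: 'r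
    proof -
      have "x + x = 0"
        using char2[OF True] by (metis mult_2 mult_zero_left)
      then show ?thesis
        by (simp add: minus_unique)
    qed
    have minus: "x - y = x + y" for x y :: 'r
      by (metis neg diff_conv_add_uminus)
    \<comment> \<open>The multiples of \<open>Q\<close> are \<open>Q\<close>, \<open>2 * Q\<close>
      and \<open>3 * Q\<close>. The last cancels against the second indicator, while
      \<open>2 * Q\<close> joins the indices above it because signs do not matter in characteristic
      2.\<close>
    have "?f j = (if j = Q then G j else 0) + (if j \<in> {2*Q..<3*Q} then G j else 0)" if "j \<in> ?J" for j
    proof -
      have j: "1 \<le> j" "j \<le> 3 * Q"
        using that True by (auto simp: J)
      have "Q dvd j \<longleftrightarrow> j \<in> {Q, 2 * Q, 3 * Q}"
      proof
        assume "Q dvd j"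
        then obtain k where k: "j = Q * k" ..
        then have "k \<noteq> 0" "k \<le> 3"
          using j Q(1) by auto
        then have "k = 1 \<or> k = 2 \<or> k = 3"
          by linarith
        with k show "j \<in> {Q, 2 * Q, 3 * Q}"
          by auto
      qed auto
      then have "(if Q dvd j then 1 else 0) - (if q * Q < j then 1 else 0) =
          (if j = Q then 1 else 0) + (if j \<in> {2*Q..<3*Q} then 1 else 0 :: 'r)"
        using Q(1) j True neg[of 1] by (auto split: if_splits)
      then show ?thesis
        using Q(1) by (auto simp: distrib_right)
    qed
    then have "sum ?f ?J = (\<Sum>j\<in>?J. (if j = Q then G j else 0) + (if j \<in> {2*Q..<3*Q} then G j else 0))"
      by (intro sum.cong refl)
    also have "\<dots> = G Q + (\<Sum>j\<in>?J. if j \<in> {2*Q..<3*Q} then G j else 0)"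
      using main \<open>r = 1\<close> unfolding sum.distrib by (simp only: sum.delta[OF fin] mult_1 if_True)
    also have "(\<Sum>j\<in>?J. if j \<in> {2*Q..<3*Q} then G j else 0) = sum G {2*Q..<3*Q}"
      using True Q(1) by (intro sum.mono_neutral_cong_right) auto
    also have "{2*Q..<3*Q} = insert (3 * Q - 1) {2*Q..<3*Q-1}"
      using Q(1) by auto
    also have "sum G \<dots> = G (3 * Q - 1) + sum G {2*Q..<3*Q-1}"
      by (subst sum.insert) auto
    also have "sum G {2*Q..<3*Q-1} = (\<Sum>i<Q-1. G (3 * Q - 2 - i))"
      by (rule sum.reindex_bij_witness[of _ "\<lambda>i. 3 * Q - 2 - i" "\<lambda>j. 3 * Q - 2 - j"])
        (auto intro!: arg_cong[where f = G])
    finally show ?thesis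
      using True by (simp add: minus algebra_simps)
  next
    case False
    then have r2: "2 \<le> r"
      using r by simp
    have top: "q * Q + Q = r * (Q + 2 * t) + 2" "q * Q = r * (Q + t) + 1"
      using r Qt by (auto simp: algebra_simps)
    define B where "B = {j. q * Q < j \<and> j \<le> q * Q + Q - 2 \<and> r dvd j}"
    have "coprime r Q"
      unfolding Qt by (metis coprime_Suc_right_nat coprime_mult_left_iff coprime_commute)
    \<comment> \<open>By coprimality \<open>j = Q * r * m\<close> with
      \<open>r * m \<le> r + 2\<close>, so either \<open>m = 1\<close> or \<open>r = m = 2\<close>;
      the second option is \<open>j = q * Q + Q\<close> with \<open>q = 3\<close>.\<close>
    have dvd_Q: "Q dvd j \<longleftrightarrow> j = r * Q \<or> j = q * Q + Q" if "j \<in> ?J" for j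
    proof
      assume "Q dvd j"
      then obtain k where k: "j = Q * k" ..
      then have "r dvd k"
        using that \<open>coprime r Q\<close> unfolding J by (auto simp: coprime_dvd_mult_right_iff)
      then obtain m where m: "k = r * m" ..
      have "0 < m"
        using that k m unfolding J by (auto intro!: Nat.gr0I)
      have "j \<le> Q * (q + 1)"
        using that unfolding J by (simp add: algebra_simps)
      then have "r * m \<le> q + 1"
        unfolding k m using Q(1) by (simp only: nat_mult_le_cancel1)
      then have "r * m \<le> r + 2"
        using r by simp
      show "j = r * Q \<or> j = q * Q + Q"
      proof (cases "m = 1")
        case False
        then have "2 \<le> m"
          using \<open>0 < m\<close> by simp
        then have "r * 2 \<le> r * m"
          by simp
        then have "r = 2"
          using \<open>r * m \<le> r + 2\<close> r2 by linarith
        moreover from this have "m = 2"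
          using \<open>r * m \<le> r + 2\<close> \<open>2 \<le> m\<close> by simp
        ultimately show ?thesis
          using k m r by simp
      qed (use k m in simp)
    qed auto
    have gt_qQ: "q * Q < j \<longleftrightarrow> j \<in> B \<or> j = q * Q + Q" if "j \<in> ?J" for j
    proof
      assume "q * Q < j"
      have "j \<noteq> q * Q + Q - 1"
      proof
        assume "j = q * Q + Q - 1"
        then have "r dvd r * (Q + 2 * t) + 1"
          using that top unfolding J by simp
        then have "r dvd 1"
          by (metis dvd_add_right_iff dvd_triv_left)
        with r2 show False
          by simp
      qed
      then show "j \<in> B \<or> j = q * Q + Q"
        using that \<open>q * Q < j\<close> unfolding J by (auto simp: B_def)
    qed (use Q(1) in \<open>auto simp: B_def\<close>)
    have B_sub: "B \<subseteq> ?J"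
      unfolding J by (auto simp: B_def)
    have "q * Q + Q \<notin> B" "r * Q \<noteq> q * Q + Q"
      using Q(1) r by (auto simp: B_def)
    \<comment> \<open>At \<open>j = q * Q + Q\<close> both indicators are \<open>1\<close> and
      cancel.\<close>
    then have "?f j = (if j = r * Q then G j else 0) - (if j \<in> B then G j else 0)" if "j \<in> ?J" for j
      unfolding dvd_Q[OF that] gt_qQ[OF that] by auto
    then have "sum ?f ?J = (\<Sum>j\<in>?J. (if j = r * Q then G j else 0) - (if j \<in> B then G j else 0))"
      by (intro sum.cong refl)
    also have "\<dots> = G (r * Q) - (\<Sum>j\<in>?J. if j \<in> B then G j else 0)"
      using main(2) unfolding sum_subtractf by (simp only: sum.delta[OF fin] if_True)
    also have "(\<Sum>j\<in>?J. if j \<in> B then G j else 0) = sum G B"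
      using B_sub fin by (intro sum.mono_neutral_cong_right) auto
    also have "sum G B = (\<Sum>i<t. G (q * Q + Q - 2 - i * r))"
    \<comment> \<open>The elements of \<open>B\<close> are \<open>r * m\<close> with
      \<open>Q + t < m \<le> Q + 2 * t\<close>; \<open>i\<close> counts them downwards from the
      largest.\<close>
    proof (rule sum.reindex_bij_witness[of _ "\<lambda>i. q * Q + Q - 2 - i * r" "\<lambda>j. Q + 2 * t - j div r"])
      have pos: "0 < r"
        using r2 by simp
      have bound: "q * Q + Q - 2 = r * (Q + 2 * t)"
        using top(1) by simp
      have B_iff: "r * m \<in> B \<longleftrightarrow> Q + t < m \<and> m \<le> Q + 2 * t" for m
      proof -
        have "r * (Q + t) + 1 < r * m \<longleftrightarrow> Q + t < m"
        proof
          assume "Q + t < m"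
          then have "r * Suc (Q + t) \<le> r * m"
            by (intro mult_le_mono2) simp
          with r2 show "r * (Q + t) + 1 < r * m"
            by simp
        next
          assume "r * (Q + t) + 1 < r * m"
          then have "r * (Q + t) < r * m"
            by linarith
          then show "Q + t < m"
            by simp
        qed
        moreover have "r * m \<in> B \<longleftrightarrow> q * Q < r * m \<and> r * m \<le> r * (Q + 2 * t)"
          unfolding B_def bound by simp
        ultimately show ?thesis
          unfolding top(2) using pos by simp
      qed
      have ix: "q * Q + Q - 2 - i * r = r * (Q + 2 * t - i)" for i
        unfolding bound by (simp add: diff_mult_distrib2 mult.commute)
      have div: "r * m div r = m" for m
        using pos by simp
      have inv_B: "q * Q + Q - 2 - (Q + 2 * t - j div r) * r = j" "Q + 2 * t - j div r \<in> {..<t}"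
        if "j \<in> B" for j
      proof -
        from that obtain m where m: "j = r * m"
          by (auto simp: B_def)
        with that B_iff[of m] have "Q + t < m" "m \<le> Q + 2 * t"
          by simp_all
        then show "q * Q + Q - 2 - (Q + 2 * t - j div r) * r = j" "Q + 2 * t - j div r \<in> {..<t}"
          unfolding ix m div by auto
      qed
      show "q * Q + Q - 2 - (Q + 2 * t - j div r) * r = j" if "j \<in> B" for j
        by (rule inv_B(1)[OF that])
      show "Q + 2 * t - j div r \<in> {..<t}" if "j \<in> B" for j
        by (rule inv_B(2)[OF that])
      show "G (q * Q + Q - 2 - (Q + 2 * t - j div r) * r) = G j" if "j \<in> B" for j
        by (simp only: inv_B(1)[OF that])
      show "Q + 2 * t - (q * Q + Q - 2 - i * r) div r = i" if "i \<in> {..<t}" for i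
        using that unfolding ix div by simp
      show "q * Q + Q - 2 - i * r \<in> B" if "i \<in> {..<t}" for i
        using that unfolding ix B_iff by auto
    qed
    finally show ?thesis
      using False main(1) by (simp add: t_def r_def)
  qed
qed

section \<open>Characteristic, signs and the final evaluation\<close>

lemma of_nat_prime_eq_0_poly_fract:
  fixes p e :: nat
  assumes "CARD('a::{finite,field}) = p ^ e"
  shows "of_nat p = (0 :: 'a poly fract)"
proof -
  have "of_nat p ^ e = (0 :: 'a)"
    using of_nat_CARD_eq_0[where 'a = 'a] by (simp add: assms)
  then have "of_nat p = (0 :: 'a poly)"
    by (simp add: of_nat_poly)
  then show ?thesis
    by (simp flip: to_fract_of_nat)
qed

text \<open>Raising to the power \<open>q\<close> fixes \<open>-1\<close>, and this is iterated; for
  even \<open>q\<close> it agrees with \<open>-1 = 1\<close>.\<close>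

lemma minus_one_power_CARD_power: "(-1) ^ (CARD('a::{finite,field}) ^ k) = (-1 :: 'a poly fract)"
proof (induction k)
  case (Suc k)
  have "(-1) ^ CARD('a) = (-1 :: 'a poly fract)"
    using minus_one_power_CARD_minus_1_dvd[of "CARD('a) - 1", where 'a = 'a]
      finite_UNIV_card_ge_0[where 'a = 'a]
    by (metis Suc_diff_1 dvd_refl finite_class.finite_UNIV mult.right_neutral power_Suc)
  with Suc show ?case
    by (simp add: mult.commute[of "CARD('a)"] power_mult)
qed simp

lemma minus_1_dvd_power_minus_1_nat: "(q - 1 :: nat) dvd (q ^ k - 1)"
proof (induction k)
  case (Suc k)
  have "q ^ Suc k - 1 = q * (q ^ k - 1) + (q - 1)"
    by (cases "q = 0") (auto simp: algebra_simps)
  with Suc show ?case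
    by simp
qed simp

lemma Int_ind_two_over:
  fixes q :: nat
  assumes "2 \<le> q"
  shows "Int_ind (2 / of_nat q :: rat) = (if q = 2 then 1 else 0)"
proof -
  have "2 / of_nat q \<notin> (\<int> :: rat set)" if "2 < q"
  proof
    assume "2 / of_nat q \<in> (\<int> :: rat set)"
    then obtain i where i: "2 / of_nat q = (of_int i :: rat)"
      by (elim Ints_cases)
    have "0 < (2 / of_nat q :: rat)" "(2 / of_nat q :: rat) < 1"
      using that by simp_all
    then show False
      unfolding i by simp
  qed
  then show ?thesis
    using assms by (auto simp: Int_ind_def)
qed

theorem theorem3p3:
  fixes p e q n d :: nat
  assumes "prime p" and "e \<ge> 1" and "q = p ^ e"
    and "CARD('a::{finite,field}) = q"
    and "n \<ge> 1" and "d \<ge> 1"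
  shows "(Delta d (int q ^ (n - 1)) (int q ^ n + 1) :: 'a poly fract) =
    Int_ind (2 / of_nat q) * Sd2 d 2 (int q ^ n + int q ^ (n - 1) - 1)
    - (\<Sum>j = 1..(int q ^ (n - 1) - 1) div (int q - 1).
         Sd2 d (3 + (j - 1) * (int q - 1))
              (int q ^ n + int q ^ (n - 1) - 2 - (j - 1) * (int q - 1)))
    + Sd2 d (2 * int q ^ (n - 1) + 1) (int q ^ n - int q ^ (n - 1))"
proof -
  define Q where "Q = q ^ (n - 1)"
  define G where "G j = (Sd2 d (int (Q + (q * Q + 1) - j)) (int j) :: 'a poly fract)" for j
  have q: "2 \<le> q"
    using card_mono[of UNIV "{0, 1 :: 'a}"] assms(4) by simp
  have Q: "0 < Q"
    using q by (simp add: Q_def)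
  have qn: "int q ^ (n - 1) = int Q" "int q ^ n = int (q * Q)"
    using assms(5) by (simp_all add: Q_def flip: power_Suc)
  have p0: "of_nat p = (0 :: 'a poly fract)"
    using assms by (intro of_nat_prime_eq_0_poly_fract) simp
  have Q_p: "Q = p ^ (e * (n - 1))" and qQ_p: "q * Q = p ^ (e * n)"
    using assms(5) by (simp_all add: Q_def assms(3) power_mult flip: power_Suc)
  have sgn: "(-1) ^ Q = (-1 :: 'a poly fract)" "(-1) ^ (q * Q) = (-1 :: 'a poly fract)"
    using minus_one_power_CARD_power[of "n - 1", where 'a = 'a]
      minus_one_power_CARD_power[of n, where 'a = 'a] assms(4,5)
    by (simp_all add: Q_def flip: power_Suc)
  \<comment> \<open>Here the field size \<open>q\<close> itself, with exponent \<open>1\<close>,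
    takes the place of the prime.\<close>
  have char2: "(2 :: 'a poly fract) = 0" if "q = 2"
    using of_nat_prime_eq_0_poly_fract[where 'a = 'a, of q 1] assms(4) that by simp
  have "(Delta d (int Q) (int (q * Q + 1)) :: 'a poly fract) =
    (\<Sum>j\<in>{j\<in>{1..<Q+(q*Q+1)}. (q - 1) dvd j}.
      ((-1) ^ Suc Q * of_nat ((j - 1) choose (Q - 1)) +
       (-1) ^ Suc (q * Q + 1) * of_nat ((j - 1) choose (q * Q + 1 - 1))) * G j)"
    using Delta_eq_sum_Sd2[of Q "q * Q + 1" d, where 'a = 'a] Q assms(4) by (simp add: G_def)
  also have "\<dots> = (\<Sum>j\<in>{j\<in>{1..<Q+(q*Q+1)}. (q - 1) dvd j}.
      ((if Q dvd j then 1 else 0) - (if q * Q < j then 1 else 0)) * G j)"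
  proof (intro sum.cong refl arg_cong2[where f = "(*)"])
    fix j
    assume "j \<in> {j\<in>{1..<Q+(q*Q+1)}. (q - 1) dvd j}"
    then have j: "1 \<le> j" "j \<le> Q + q * Q"
      by auto
    have "2 * Q \<le> q * Q"
      using q by simp
    \<comment> \<open>Below this bound \<open>(j - 1) choose (q * Q)\<close> reduces to a plain
      threshold indicator.\<close>
    then have "j - 1 < 2 * (q * Q)"
      using j Q by linarith
    from of_nat_choose_prime_power[OF assms(1) p0 qQ_p this]
    have "of_nat ((j - 1) choose (q * Q)) = (if q * Q < j then 1 else 0 :: 'a poly fract)"
      using j by auto
    moreover have "of_nat ((j - 1) choose (Q - 1)) = (if Q dvd j then 1 else 0 :: 'a poly fract)"
      using of_nat_choose_prime_power_minus_1[OF assms(1) p0 Q_p, of "j - 1"] j by simp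
    ultimately show "(-1) ^ Suc Q * of_nat ((j - 1) choose (Q - 1)) +
        (-1) ^ Suc (q * Q + 1) * of_nat ((j - 1) choose (q * Q + 1 - 1)) =
        ((if Q dvd j then 1 else 0) - (if q * Q < j then 1 else 0) :: 'a poly fract)"
      by (simp add: sgn)
  qed
  also have "\<dots> = (if q = 2 then G (q * Q + Q - 1) else 0) -
      (\<Sum>i<(Q - 1) div (q - 1). G (q * Q + Q - 2 - i * (q - 1))) + G (q * Q - Q)"
    using q Q char2 minus_1_dvd_power_minus_1_nat[of q "n - 1"]
    by (intro sum_weighted_multiples) (simp_all add: Q_def)
  also have "(if q = 2 then G (q * Q + Q - 1) else 0) =
      Int_ind (2 / of_nat q) * Sd2 d 2 (int (q * Q) + int Q - 1)"
    using q Q by (simp add: Int_ind_two_over G_def of_nat_diff)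
  also have "G (q * Q - Q) = Sd2 d (2 * int Q + 1) (int (q * Q) - int Q)"
    using q by (simp add: G_def of_nat_diff algebra_simps)
  also have "(\<Sum>i<(Q - 1) div (q - 1). G (q * Q + Q - 2 - i * (q - 1))) =
      (\<Sum>j = 1..(int Q - 1) div (int q - 1).
         Sd2 d (3 + (j - 1) * (int q - 1)) (int (q * Q) + int Q - 2 - (j - 1) * (int q - 1)))"
  proof (rule sum.reindex_bij_witness[of _ "\<lambda>j. nat (j - 1)" "\<lambda>i. int i + 1"])
    have div: "(int Q - 1) div (int q - 1) = int ((Q - 1) div (q - 1))"
      using q Q by (simp add: zdiv_int of_nat_diff)
    show "int i + 1 \<in> {1..(int Q - 1) div (int q - 1)}" if "i \<in> {..<(Q - 1) div (q - 1)}" for i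
      using that unfolding div by auto
    show "nat (j - 1) \<in> {..<(Q - 1) div (q - 1)}" if "j \<in> {1..(int Q - 1) div (int q - 1)}" for j
      using that unfolding div by auto
    show "Sd2 d (3 + (int i + 1 - 1) * (int q - 1))
        (int (q * Q) + int Q - 2 - (int i + 1 - 1) * (int q - 1)) = G (q * Q + Q - 2 - i * (q - 1))"
      if "i \<in> {..<(Q - 1) div (q - 1)}" for i
    proof -
      have "i * (q - 1) \<le> (Q - 1) div (q - 1) * (q - 1)"
        using that by (intro mult_le_mono1) simp
      also have "\<dots> \<le> Q - 1"
        by (simp add: div_times_less_eq_dividend)
      \<comment> \<open>This bound ensures that none of the natural subtractions in \<open>G\<close>
        is truncated.\<close>
      finally have le: "i * (q - 1) \<le> Q - 1" .
      have "2 * Q \<le> q * Q"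
        using q by simp
      then have "int (q * Q + Q - 2 - i * (q - 1)) = int (q * Q) + int Q - 2 - int (i * (q - 1))"
        "int (Q + (q * Q + 1) - (q * Q + Q - 2 - i * (q - 1))) = 3 + int (i * (q - 1))"
        using le Q by linarith+
      moreover have "int (i * (q - 1)) = int i * (int q - 1)"
        using q by (simp add: of_nat_diff)
      ultimately show ?thesis
        by (simp only: G_def add_diff_cancel_right')
    qed
  qed auto
  finally show ?thesis
    unfolding qn by (simp only: of_nat_add of_nat_1)
qed

end
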